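(* Let $\mathcal{A}$ be a unital Banach algebra, let $a\in\mathcal{A}$ be Moore-Penrose invertible with Moore-Penrose inverse $a^{\dagger}$, and let $\lambda,\mu\in\mathbb{C}\setminus\{0\}$. The following statements are equivalent. (i) $aa^{\dagger}-a^{\dagger}a\in\mathcal{A}^{-1}$; (ii) $\mathcal{A}=a\mathcal{A}\oplus a^{\dagger}\mathcal{A}$ and $\mathcal{A}=\mathcal{A}a\oplus\mathcal{A}a^{\dagger}$; (iii) $\lambda a+\mu a^{\dagger}\in\mathcal{A}^{-1}$ and $a\mathcal{A}\cap a^{\dagger}\mathcal{A}=0$; (iv) $\lambda a+\mu a^{\dagger}\in\mathcal{A}^{-1}$ and there exists an idempotent $h\in\mathcal{A}$ such that $ha=a$ and $ha^{\dagger}=0$; (v) $L_{\lambda a+\mu a^{\dagger}}$ and $R_{\lambda a+\mu a^{\dagger}}$ are right invertible in $\mathcal{L}(\mathcal{A})$ and $a\mathcal{A}\cap a^{\dagger}\mathcal{A}=0$; (vi) $aa^{\dagger}+a^{\dagger}a\in\mathcal{A}^{-1}$ and $a\mathcal{A}\cap a^{\dagger}\mathcal{A}=0$; (vii) $\lambda a+\mu a^{\dagger}\in\mathcal{A}^{-1}$ and there exists an idempotent $k\in\mathcal{A}$ such that $ak=a$ and $a^{\dagger}k=0$; (viii) $aa^{\dagger}+a^{\dagger}a\in\mathcal{A}^{-1}$ and $\mathcal{A}a\cap\mathcal{A}a^{\dagger}=0$; (ix) $\lambda a+\mu a^{\dagger}\in\mathcal{A}^{-1}$ and $\mathcal{A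}a\cap\mathcal{A}a^{\dagger}=0$.
   Context: $\mathcal{A}$ denotes a complex unital Banach algebra with unit $1$, and $\mathcal{A}^{-1}$ is its set of invertible elements. An element $c\in\mathcal{A}$ is hermitian if $\|\exp(itc)\|=1$ for all $t\in\mathbb{R}$. An element $a\in\mathcal{A}$ is Moore-Penrose invertible if there exists $x\in\mathcal{A}$ with $axa=a$, $xax=x$ and both $ax$ and $xa$ hermitian; such $x$ is unique, is called the Moore-Penrose inverse of $a$ and is denoted $a^{\dagger}$. For $c\in\mathcal{A}$: $c\mathcal{A}=\{cx: x\in\mathcal{A}\}$, $\mathcal{A}c=\{xc: x\in\mathcal{A}\}$, and $L_c,R_c:\mathcal{A}\to\mathcal{A}$ are the maps $L_c(x)=cx$, $R_c(x)=xc$. $\mathcal{L}(\mathcal{A})$ is the Banach algebra of bounded linear maps from $\mathcal{A}$ to itself. The symbol $\oplus$ denotes the (internal) direct sum of linear subspaces, and $0$ also denotes the zero subspace. *)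

theory Defs
  imports "HOL-Analysis.Analysis"
begin

text \<open>The real scalar multiplication inherited from \<open>real_normed_algebra_1\<close> is the restriction
  of the complex one, so that the library's \<open>exp\<close> is the exponential of the complex algebra.
  That class also requires \<open>norm 1 = 1\<close>.  This loses nothing for Moore-Penrose invertible elements:
  a hermitian element exists only if \<open>norm (exp 0) = norm 1\<close> equals 1.\<close>

class complex_banach_algebra_1 = real_normed_algebra_1 + banach +
  fixes scaleC :: "complex \<Rightarrow> 'a \<Rightarrow> 'a" (infixr "*\<^sub>C" 75)
  assumes scaleC_add_right: "z *\<^sub>C (x + y) = z *\<^sub>C x + z *\<^sub>C y"
    and scaleC_add_left: "(z + w) *\<^sub>C x = z *\<^sub>C x + w *\<^sub>C x"
    and scaleC_scaleC: "z *\<^sub>C w *\<^sub>C x = (z * w) *\<^sub>C x"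
    and scaleR_scaleC: "r *\<^sub>R x = complex_of_real r *\<^sub>C x"
    and mult_scaleC_left: "(z *\<^sub>C x) * y = z *\<^sub>C (x * y)"
    and mult_scaleC_right: "x * (z *\<^sub>C y) = z *\<^sub>C (x * y)"
    and norm_scaleC: "norm (z *\<^sub>C x) = cmod z * norm x"

instantiation complex :: complex_banach_algebra_1
begin

definition scaleC_complex :: "complex \<Rightarrow> complex \<Rightarrow> complex"
  where "scaleC_complex z x = z * x"

instance
  by standard (auto simp: scaleC_complex_def algebra_simps norm_mult scaleR_conv_of_real)

end

lemma scaleC_one: "1 *\<^sub>C x = (x :: 'a::complex_banach_algebra_1)"
  using scaleR_scaleC[of 1 x] by simp

global_interpretation complex_vector:
  vector_space "scaleC :: complex \<Rightarrow> 'a \<Rightarrow> 'a::complex_banach_algebra_1"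
  defines csubspace = complex_vector.subspace
  by unfold_locales
    (simp_all add: scaleC_add_right scaleC_add_left scaleC_scaleC scaleC_one)

definition bounded_clinear ::
    "('a::complex_banach_algebra_1 \<Rightarrow> 'b::complex_banach_algebra_1) \<Rightarrow> bool"
  where "bounded_clinear f \<longleftrightarrow>
    Vector_Spaces.linear scaleC scaleC f \<and> (\<exists>K. \<forall>x. norm (f x) \<le> norm x * K)"

text \<open>The product of the algebra of bounded operators is composition, its unit is \<open>id\<close>.\<close>

definition right_invertible_operator :: "('a::complex_banach_algebra_1 \<Rightarrow> 'a) \<Rightarrow> bool"
  where "right_invertible_operator F \<longleftrightarrow>
    bounded_clinear F \<and> (\<exists>G. bounded_clinear G \<and> F \<circ> G = id)"

definition left_mult :: "'a::times \<Rightarrow> 'a \<Rightarrow> 'a"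
  where "left_mult c = (\<lambda>x. c * x)"

definition right_mult :: "'a::times \<Rightarrow> 'a \<Rightarrow> 'a"
  where "right_mult c = (\<lambda>x. x * c)"

definition principal_right_ideal :: "'a::times \<Rightarrow> 'a set"
  where "principal_right_ideal c = {c * x | x. True}"

definition principal_left_ideal :: "'a::times \<Rightarrow> 'a set"
  where "principal_left_ideal c = {x * c | x. True}"

definition invertible_elements :: "'a::monoid_mult set"
  where "invertible_elements = {x. \<exists>y. x * y = 1 \<and> y * x = 1}"

definition idempotent :: "'a::times \<Rightarrow> bool"
  where "idempotent h \<longleftrightarrow> h * h = h"

definition is_direct_sum :: "'a::complex_banach_algebra_1 set \<Rightarrow> 'a set \<Rightarrow> 'a set \<Rightarrow> bool"
  where "is_direct_sum V S T \<longleftrightarrow>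
    csubspace S \<and> csubspace T \<and> V = {s + t | s t. s \<in> S \<and> t \<in> T} \<and> S \<inter> T = {0}"

definition hermitian :: "'a::complex_banach_algebra_1 \<Rightarrow> bool"
  where "hermitian c \<longleftrightarrow> (\<forall>t::real. norm (exp ((\<i> * complex_of_real t) *\<^sub>C c)) = 1)"

definition is_moore_penrose_inverse :: "'a::complex_banach_algebra_1 \<Rightarrow> 'a \<Rightarrow> bool"
  where "is_moore_penrose_inverse a x \<longleftrightarrow>
    a * x * a = a \<and> x * a * x = x \<and> hermitian (a * x) \<and> hermitian (x * a)"

definition moore_penrose_invertible :: "'a::complex_banach_algebra_1 \<Rightarrow> bool"
  where "moore_penrose_invertible a \<longleftrightarrow> (\<exists>x. is_moore_penrose_inverse a x)"

definition moore_penrose_inverse :: "'a::complex_banach_algebra_1 \<Rightarrow> 'a" ("_\<^sup>\<dagger>" [1000] 999)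
  where "a\<^sup>\<dagger> = (THE x. is_moore_penrose_inverse a x)"

lemma bounded_linear_scaleC_left:
  "bounded_linear (\<lambda>z. z *\<^sub>C (x :: 'a::complex_banach_algebra_1))"
  by (rule bounded_linear_intro[where K = "norm x"])
    (simp_all add: scaleC_add_left norm_scaleC scaleR_scaleC scaleC_scaleC scaleR_conv_of_real
        scaleC_complex_def)

lemma exp_scaleC_idempotent:
  fixes p :: "'a::complex_banach_algebra_1"
  assumes "p * p = p"
  shows "exp (z *\<^sub>C p) = 1 + (exp z - 1) *\<^sub>C p"
proof -
  have pow: "(z *\<^sub>C p) ^ Suc n = (z ^ Suc n) *\<^sub>C p" for n
    by (induction n) (simp_all add: mult_scaleC_left mult_scaleC_right scaleC_scaleC assms)
  have "(\<lambda>n. z ^ n /\<^sub>R fact n) sums exp z"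
    by (rule exp_converges)
  then have "(\<lambda>n. (z ^ n /\<^sub>R fact n) *\<^sub>C p) sums (exp z *\<^sub>C p)"
    by (rule bounded_linear.sums[OF bounded_linear_scaleC_left])
  moreover have "(\<lambda>n. if n = 0 then 1 - p else 0) sums (1 - p)"
    using sums_single[of 0 "\<lambda>_. 1 - p"] by simp
  ultimately have "(\<lambda>n. (z ^ n /\<^sub>R fact n) *\<^sub>C p + (if n = 0 then 1 - p else 0))
      sums (exp z *\<^sub>C p + (1 - p))"
    by (rule sums_add)
  moreover have "(\<lambda>n. (z ^ n /\<^sub>R fact n) *\<^sub>C p + (if n = 0 then 1 - p else 0))
      = (\<lambda>n. (z *\<^sub>C p) ^ n /\<^sub>R fact n)"
  proof
    fix n show "(z ^ n /\<^sub>R fact n) *\<^sub>C p + (if n = 0 then 1 - p else 0)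
      = (z *\<^sub>C p) ^ n /\<^sub>R fact n"
    proof (cases n)
      case 0 then show ?thesis by (simp add: scaleC_one)
    next
      case (Suc k) then show ?thesis
        unfolding Suc pow by (simp add: scaleR_scaleC scaleC_scaleC scaleR_conv_of_real
        scaleC_complex_def)
    qed
  qed
  ultimately have "exp (z *\<^sub>C p) = exp z *\<^sub>C p + (1 - p)"
    using sums_unique2[OF exp_converges[of "z *\<^sub>C p"]] by simp
  also have "\<dots> = 1 + (exp z - 1) *\<^sub>C p"
    by (simp add: complex_vector.scale_left_diff_distrib scaleC_one)
  finally show ?thesis .
qed

lemma hermitian_idempotents_eq:
  fixes p q :: "'a::complex_banach_algebra_1"
  assumes p: "hermitian p" "p * p = p" and q: "hermitian q" "q * q = q"
    and pq: "(p * q = q \<and> q * p = p) \<or> (p * q = p \<and> q * p = q)"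
  shows "p = q"
proof (rule ccontr)
  assume "p \<noteq> q"
  define d where "d = p - q"
  have dd: "d * d = 0" using pq p q by (auto simp: d_def algebra_simps)
  have ep: "exp ((\<i> * complex_of_real pi) *\<^sub>C p) = 1 - 2 *\<^sub>C p"
    using exp_scaleC_idempotent[OF p(2), of "\<i> * complex_of_real pi"]
    by (simp add: complex_vector.scale_minus_left mult.commute)
  have eq: "exp ((\<i> * complex_of_real pi) *\<^sub>C q) = 1 - 2 *\<^sub>C q"
    using exp_scaleC_idempotent[OF q(2), of "\<i> * complex_of_real pi"]
    by (simp add: complex_vector.scale_minus_left mult.commute)
  have two: "2 *\<^sub>C x = x + x" for x :: 'a
    using scaleC_add_left[of 1 1 x] by (simp add: scaleC_one)
  have np: "norm (1 - (p + p)) = 1" and nq: "norm (1 - (q + q)) = 1"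
    using p(1) q(1) ep eq unfolding hermitian_def two by metis+
  define u where "u = (1 - (p + p)) * (1 - (q + q))"
  have u: "u = 1 + (d + d) \<or> u = 1 - (d + d)"
    using pq by (auto simp: u_def d_def algebra_simps)
  have "norm u \<le> 1" using norm_mult_ineq[of "1 - (p + p)" "1 - (q + q)"] np nq
    by (simp add: u_def)
  then have nu: "norm (u ^ n) \<le> 1" for n
    using norm_power_ineq[of u n] power_le_one[of "norm u" n] by simp
  obtain e :: 'a where e: "u = 1 + e" "e * e = 0" "norm e = 2 * norm d"
  proof -
    have "norm (d + d) = 2 * norm d" by (simp flip: scaleR_2)
    moreover have "norm (- (d + d)) = norm (d + d)" by (rule norm_minus_cancel)
    moreover have "(d + d) * (d + d) = 0" "- (d + d) * - (d + d) = 0"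
      using dd by (simp_all add: algebra_simps)
    moreover have "u = 1 + (d + d) \<or> u = 1 + - (d + d)" using u by (simp only: diff_conv_add_uminus)
    ultimately show ?thesis using that by metis
  qed
  have en: "e * (of_nat n * e) = 0" for n
    by (metis e(2) mult.assoc mult_of_nat_commute mult_zero_right)
  have pw: "u ^ n = 1 + of_nat n * e" for n
    by (induction n) (simp_all add: e(1) en distrib_left distrib_right)
  have bd: "real n * norm e \<le> 2" for n
  proof -
    have "real n *\<^sub>R e = u ^ n - 1" by (simp add: pw scaleR_conv_of_real)
    then have "norm (real n *\<^sub>R e) \<le> norm (u ^ n) + norm (1::'a)"
      by (metis norm_triangle_ineq4)
    then show ?thesis using nu[of n] by simp
  qed
  have "norm e > 0" using e(3) \<open>p \<noteq> q\<close> by (simp add: d_def)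
  then obtain n where "2 < real n * norm e" using reals_Archimedean3 by blast
  with bd[of n] show False by simp
qed

lemma is_moore_penrose_inverse_unique:
  assumes x: "is_moore_penrose_inverse a x" and y: "is_moore_penrose_inverse a y"
  shows "x = y"
proof -
  note d = x[unfolded is_moore_penrose_inverse_def] y[unfolded is_moore_penrose_inverse_def]
  have ax: "a * x * a = a" and ay: "a * y * a = a"
    and xa: "x * a * x = x" and ya: "y * a * y = y" using d by auto
  have "a * x = a * y"
    by (rule hermitian_idempotents_eq) (use d in \<open>auto simp flip: mult.assoc\<close>)
  moreover have "x * a = y * a"
    by (rule hermitian_idempotents_eq) (use d in \<open>auto simp: mult.assoc\<close>)
  ultimately show ?thesis using xa ya by (metis mult.assoc)
qed

lemma moore_penrose_inverse_eqI:
  "is_moore_penrose_inverse a x \<Longrightarrow> a\<^sup>\<dagger> = x"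
  unfolding moore_penrose_inverse_def by (blast intro: is_moore_penrose_inverse_unique)

end

theory Submission
  imports Defs
begin

text \<open>All nine conditions express that the pair \<open>(a, a\<^sup>\<dagger>)\<close> is \<^emph>\<open>complementary\<close>: both one-sided
  decompositions in (ii) hold.  In any ring with unit, a pair \<open>(x, y)\<close> is complementary iff \<open>x + y\<close> is
  invertible and \<open>xA \<inter> yA = 0\<close>, and symmetrically iff \<open>x + y\<close> is invertible and \<open>Ax \<inter> Ay = 0\<close>: if \<open>h\<close> is
  the projection onto \<open>xA\<close> along \<open>yA\<close>, then conjugating it by \<open>x + y\<close> yields the projection for the
  left ideals.  Complementarity depends only on the ideals generated by \<open>x\<close> and \<open>y\<close>, so this can be
  applied to the pairs \<open>(\<lambda>a, \<mu>a\<^sup>\<dagger>)\<close>, \<open>(aa\<^sup>\<dagger>, a\<^sup>\<dagger>a)\<close> and \<open>(aa\<^sup>\<dagger>, -a\<^sup>\<dagger>a)\<close>; for the last one the sum is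
  a difference of idempotents, and then the intersection is automatically zero.\<close>

section \<open>Principal one-sided ideals and their generators\<close>

lemma Int_principal_right_ideals_eq_0_iff:
  fixes x y :: "'a::ring_1"
  shows "principal_right_ideal x \<inter> principal_right_ideal y = {0} \<longleftrightarrow>
    (\<forall>c d. x * c = y * d \<longrightarrow> x * c = 0)"
proof -
  have "0 \<in> principal_right_ideal x \<inter> principal_right_ideal y"
    unfolding principal_right_ideal_def by (simp, metis mult_zero_right)
  then show ?thesis unfolding principal_right_ideal_def by blast
qed

lemma Int_principal_left_ideals_eq_0_iff:
  fixes x y :: "'a::ring_1"
  shows "principal_left_ideal x \<inter> principal_left_ideal y = {0} \<longleftrightarrow>
    (\<forall>c d. c * x = d * y \<longrightarrow> c * x = 0)"
proof -
  have "0 \<in> principal_left_ideal x \<inter> principal_left_ideal y"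
    unfolding principal_left_ideal_def by (simp, metis mult_zero_left)
  then show ?thesis unfolding principal_left_ideal_def by blast
qed

lemma principal_right_ideal_mono:
  fixes x c :: "'a::semigroup_mult"
  shows "principal_right_ideal (x * c) \<subseteq> principal_right_ideal x"
  by (auto simp: principal_right_ideal_def mult.assoc)

lemma principal_left_ideal_mono:
  fixes x c :: "'a::semigroup_mult"
  shows "principal_left_ideal (c * x) \<subseteq> principal_left_ideal x"
  by (auto simp: principal_left_ideal_def simp flip: mult.assoc)

text \<open>One inclusion always holds, and \<open>x = (x * c) * d\<close> returns the other. This
  lets signs, nonzero scalars and factors such as \<open>a\<^sup>\<dagger>\<close> be dropped from a
  generator.\<close>

lemma principal_right_ideal_eqI:
  fixes x c d :: "'a::semigroup_mult"
  assumes "x * c * d = x"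
  shows "principal_right_ideal (x * c) = principal_right_ideal x"
  using principal_right_ideal_mono[of x c] principal_right_ideal_mono[of "x * c" d] assms by auto

lemma principal_left_ideal_eqI:
  fixes x c d :: "'a::semigroup_mult"
  assumes "d * (c * x) = x"
  shows "principal_left_ideal (c * x) = principal_left_ideal x"
  using principal_left_ideal_mono[of c x] principal_left_ideal_mono[of d "c * x"] assms by auto

lemma principal_right_ideal_minus:
  "principal_right_ideal (- x) = principal_right_ideal (x :: 'a::ring_1)"
  using principal_right_ideal_eqI[of x "- 1" "- 1"] by simp

lemma principal_left_ideal_minus:
  "principal_left_ideal (- x) = principal_left_ideal (x :: 'a::ring_1)"
  using principal_left_ideal_eqI[of "- 1" "- 1" x] by simp

lemma principal_right_ideal_scaleC:
  fixes x :: "'a::complex_banach_algebra_1"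
  assumes "z \<noteq> 0"
  shows "principal_right_ideal (z *\<^sub>C x) = principal_right_ideal x"
  \<comment> \<open>The scalar acts as right multiplication by \<open>z *\<^sub>C 1\<close>, which
    \<open>inverse z *\<^sub>C 1\<close> undoes.\<close>
  using principal_right_ideal_eqI[of x "z *\<^sub>C 1" "inverse z *\<^sub>C 1"] assms
  by (simp add: mult_scaleC_right mult_scaleC_left scaleC_scaleC scaleC_one)

lemma principal_left_ideal_scaleC:
  fixes x :: "'a::complex_banach_algebra_1"
  assumes "z \<noteq> 0"
  shows "principal_left_ideal (z *\<^sub>C x) = principal_left_ideal x"
  using principal_left_ideal_eqI[of "inverse z *\<^sub>C 1" "z *\<^sub>C 1" x] assms
  by (simp add: mult_scaleC_right mult_scaleC_left scaleC_scaleC scaleC_one)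

section \<open>Complementary pairs in a ring with unit\<close>

lemma invertible_elementsI:
  fixes x :: "'a::monoid_mult"
  assumes "x * y = 1" "z * x = 1"
  shows "x \<in> invertible_elements"
proof -
  have "z = y" using assms by (metis mult.assoc mult_1_left mult_1_right)
  then show ?thesis using assms by (auto simp: invertible_elements_def)
qed

text \<open>Splitting 1 stands for splitting the whole ring, since ideals absorb multiples. Only the
  generated ideals occur in the formula, so generators can be exchanged by rewriting.\<close>

definition complementary :: "'a::ring_1 \<Rightarrow> 'a \<Rightarrow> bool"
  where "complementary x y \<longleftrightarrow>
    (\<exists>s \<in> principal_right_ideal x. \<exists>t \<in> principal_right_ideal y. s + t = 1) \<and>
    (\<exists>s \<in> principal_left_ideal x. \<exists>t \<in> principal_left_ideal y. s + t = 1) \<and>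
    principal_right_ideal x \<inter> principal_right_ideal y = {0} \<and>
    principal_left_ideal x \<inter> principal_left_ideal y = {0}"

text \<open>Multiplying the splitting of 1 by \<open>x\<close> gives
  \<open>x - x * u * x = y * v * x\<close>, an element of both ideals, hence zero; likewise
  \<open>x * u * y = y - y * v * y\<close>. Thus left multiplication by \<open>x * u\<close> is the
  projection onto the right ideal of \<open>x\<close> along that of \<open>y\<close>.\<close>

lemma projection_of_right_decomposition:
  fixes x y :: "'a::ring_1"
  assumes "x * u + y * v = 1"
    and "principal_right_ideal x \<inter> principal_right_ideal y = {0}"
  shows "x * u * x = x" and "x * u * y = 0"
proof -
  note int = assms(2)[unfolded Int_principal_right_ideals_eq_0_iff, rule_format]
  have split: "x * u * z + y * v * z = z" for z
    using assms(1) by (simp flip: distrib_right)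
  have "x * (1 - u * x) = y * (v * x)"
    using split[of x] by (simp add: algebra_simps)
  from int[OF this] show "x * u * x = x"
    by (simp add: algebra_simps)
  have "x * (u * y) = y * (1 - v * y)"
    using split[of y] by (simp add: algebra_simps)
  from int[OF this] show "x * u * y = 0"
    by (simp add: mult.assoc)
qed

text \<open>Mirror image: right multiplication by \<open>u * x\<close> projects onto the left ideal
  of \<open>x\<close> along that of \<open>y\<close>.\<close>

lemma projection_of_left_decomposition:
  fixes x y :: "'a::ring_1"
  assumes "u * x + v * y = 1"
    and "principal_left_ideal x \<inter> principal_left_ideal y = {0}"
  shows "x * (u * x) = x" and "y * (u * x) = 0"
proof -
  note int = assms(2)[unfolded Int_principal_left_ideals_eq_0_iff, rule_format]
  have split: "z * (u * x) + z * (v * y) = z" for z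
    using assms(1) by (simp flip: distrib_left)
  have "(1 - x * u) * x = (x * v) * y"
    using split[of x] by (simp add: algebra_simps)
  from int[OF this] show "x * (u * x) = x"
    by (simp add: algebra_simps)
  have "(y * u) * x = (1 - y * v) * y"
    using split[of y] by (simp add: algebra_simps)
  from int[OF this] show "y * (u * x) = 0"
    by (simp add: mult.assoc)
qed

text \<open>The projections satisfy \<open>h * (x + y) = x\<close> and
  \<open>(x + y) * k = x\<close>, while \<open>1 - h\<close> and \<open>1 - k\<close> cut out
  \<open>y\<close>. The splitting of 1 by left ideals then yields a left inverse of
  \<open>x + y\<close>, the one by right ideals a right inverse.\<close>

lemma complementary_imp_invertible:
  fixes x y :: "'a::ring_1"
  assumes "complementary x y"
  shows "x + y \<in> invertible_elements"
proof -
  obtain u v u' v' where uv: "x * u + y * v = 1" and uv': "u' * x + v' * y = 1"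
    using assms unfolding complementary_def principal_right_ideal_def principal_left_ideal_def
    by blast
  define h k where "h = x * u" and "k = u' * x"
  have h: "h * x = x" "h * y = 0"
    using projection_of_right_decomposition[OF uv] assms by (auto simp: h_def complementary_def)
  have k: "x * k = x" "y * k = 0"
    using projection_of_left_decomposition[OF uv'] assms by (auto simp: k_def complementary_def)
  have "(x + y) * (k * u + (1 - k) * v) = (x * k + y * k) * u + (x + y - (x * k + y * k)) * v"
    by (simp add: algebra_simps)
  also have "\<dots> = 1" using uv k by simp
  finally have R: "(x + y) * (k * u + (1 - k) * v) = 1" .
  have "(u' * h + v' * (1 - h)) * (x + y) = u' * (h * x + h * y) + v' * (x + y - (h * x + h * y))"
    by (simp add: algebra_simps)
  also have "\<dots> = 1" using uv' h by simp
  finally show ?thesis by (rule invertible_elementsI[OF R])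
qed

text \<open>Conjugation by \<open>x + y\<close> turns the projection \<open>x * s\<close> into
  \<open>s * x\<close>. Subtracting \<open>x * (s * x) = x\<close> from
  \<open>(x + y) * (s * x) = x\<close> gives \<open>y * (s * x) = 0\<close>, so right multiplication
  by \<open>s * x\<close> fixes \<open>c * x\<close> and kills \<open>d * y\<close>.\<close>

lemma Int_right_ideals_imp_Int_left_ideals:
  fixes x y :: "'a::ring_1"
  assumes s: "s * (x + y) = 1" "(x + y) * s = 1"
    and int: "principal_right_ideal x \<inter> principal_right_ideal y = {0}"
  shows "principal_left_ideal x \<inter> principal_left_ideal y = {0}"
proof -
  have "x * s + y * s = 1" using s by (simp add: distrib_right)
  note h = projection_of_right_decomposition[OF this int]
  have "x * s * (x + y) = x" using s by (simp add: mult.assoc)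
  have xk: "x * (s * x) = x" using h by (simp add: mult.assoc)
  have "(x + y) * s * x = x" using s by simp
  then have yk: "y * (s * x) = 0" using xk by (simp add: distrib_right mult.assoc)
  have "c * x = 0" if "c * x = d * y" for c d
  proof -
    have "c * x = d * y * (s * x)" using that xk by (metis mult.assoc)
    then show ?thesis using yk by (simp add: mult.assoc)
  qed
  then show ?thesis by (simp add: Int_principal_left_ideals_eq_0_iff)
qed

text \<open>Conjugation in the other direction turns \<open>s * x\<close> back into
  \<open>x * s\<close>; left multiplication by it fixes \<open>x\<close> and kills
  \<open>y\<close>.\<close>

lemma Int_left_ideals_imp_Int_right_ideals:
  fixes x y :: "'a::ring_1"
  assumes s: "s * (x + y) = 1" "(x + y) * s = 1"
    and int: "principal_left_ideal x \<inter> principal_left_ideal y = {0}"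
  shows "principal_right_ideal x \<inter> principal_right_ideal y = {0}"
proof -
  have "s * x + s * y = 1" using s by (simp add: distrib_left)
  note k = projection_of_left_decomposition[OF this int]
  have hx: "x * s * x = x" using k by (simp add: mult.assoc)
  have "x * s * (x + y) = x" using s by (simp add: mult.assoc)
  then have hy: "x * s * y = 0" using hx by (simp add: distrib_left)
  have "x * c = 0" if "x * c = y * d" for c d
  proof -
    have "x * c = x * s * (y * d)" using that hx by (metis mult.assoc)
    then show ?thesis using hy by (simp flip: mult.assoc)
  qed
  then show ?thesis by (simp add: Int_principal_right_ideals_eq_0_iff)
qed

text \<open>Expanding \<open>(x + y) * s = 1\<close> and \<open>s * (x + y) = 1\<close> provides
  both splittings of 1 at once; the trivial intersection passes from the right ideals to the left
  ones.\<close>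

lemma complementary_iff_right:
  fixes x y :: "'a::ring_1"
  shows "complementary x y \<longleftrightarrow> x + y \<in> invertible_elements \<and>
    principal_right_ideal x \<inter> principal_right_ideal y = {0}" (is "_ \<longleftrightarrow> ?R")
proof
  assume "complementary x y"
  then show ?R by (simp add: complementary_imp_invertible) (simp add: complementary_def)
next
  assume R: ?R
  then obtain s where s: "s * (x + y) = 1" "(x + y) * s = 1"
    by (auto simp: invertible_elements_def)
  have "x * s + y * s = 1" "s * x + s * y = 1" using s by (simp_all add: algebra_simps)
  moreover have "x * s \<in> principal_right_ideal x" "y * s \<in> principal_right_ideal y"
      "s * x \<in> principal_left_ideal x" "s * y \<in> principal_left_ideal y"
    by (auto simp: principal_right_ideal_def principal_left_ideal_def)
  moreover have "principal_left_ideal x \<inter> principal_left_ideal y = {0}"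
    by (rule Int_right_ideals_imp_Int_left_ideals[OF s]) (use R in simp)
  ultimately show "complementary x y"
    using R unfolding complementary_def by metis
qed

lemma complementary_iff_left:
  fixes x y :: "'a::ring_1"
  shows "complementary x y \<longleftrightarrow> x + y \<in> invertible_elements \<and>
    principal_left_ideal x \<inter> principal_left_ideal y = {0}" (is "_ \<longleftrightarrow> ?R")
proof
  assume "complementary x y"
  then show ?R by (simp add: complementary_imp_invertible) (simp add: complementary_def)
next
  assume R: ?R
  then obtain s where s: "s * (x + y) = 1" "(x + y) * s = 1"
    by (auto simp: invertible_elements_def)
  have "principal_right_ideal x \<inter> principal_right_ideal y = {0}"
    by (rule Int_left_ideals_imp_Int_right_ideals[OF s]) (use R in simp)
  with R show "complementary x y" by (simp add: complementary_iff_right)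
qed

text \<open>The idempotent is the projection \<open>x * s\<close>, with \<open>s\<close> a right
  inverse of \<open>x + y\<close>. Conversely, left multiplication by \<open>h\<close> fixes the
  right ideal of \<open>x\<close> and kills that of \<open>y\<close>, so a common element is
  zero.\<close>

lemma Int_right_ideals_iff_idempotent:
  fixes x y :: "'a::ring_1"
  assumes "x + y \<in> invertible_elements"
  shows "principal_right_ideal x \<inter> principal_right_ideal y = {0} \<longleftrightarrow>
    (\<exists>h. idempotent h \<and> h * x = x \<and> h * y = 0)" (is "?L \<longleftrightarrow> ?R")
proof
  assume int: ?L
  obtain s where "(x + y) * s = 1" using assms unfolding invertible_elements_def by blast
  then have "x * s + y * s = 1" by (simp add: distrib_right)
  note h = projection_of_right_decomposition[OF this int]
  then have "idempotent (x * s)" by (simp add: idempotent_def flip: mult.assoc)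
  with h show ?R by blast
next
  assume ?R
  then obtain h where h: "h * x = x" "h * y = 0" by blast
  have "x * c = 0" if "x * c = y * d" for c d
    using that h by (metis mult.assoc mult_zero_left)
  then show ?L by (simp add: Int_principal_right_ideals_eq_0_iff)
qed

lemma Int_left_ideals_iff_idempotent:
  fixes x y :: "'a::ring_1"
  assumes "x + y \<in> invertible_elements"
  shows "principal_left_ideal x \<inter> principal_left_ideal y = {0} \<longleftrightarrow>
    (\<exists>k. idempotent k \<and> x * k = x \<and> y * k = 0)" (is "?L \<longleftrightarrow> ?R")
proof
  assume int: ?L
  obtain s where "s * (x + y) = 1" using assms unfolding invertible_elements_def by blast
  then have "s * x + s * y = 1" by (simp add: distrib_left)
  note k = projection_of_left_decomposition[OF this int]
  then have "idempotent (s * x)" by (simp add: idempotent_def mult.assoc)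
  with k show ?R by blast
next
  assume ?R
  then obtain k where k: "x * k = x" "y * k = 0" by blast
  have "c * x = 0" if "c * x = d * y" for c d
    using that k by (metis mult.assoc mult_zero_right)
  then show ?L by (simp add: Int_principal_left_ideals_eq_0_iff)
qed

text \<open>A common element \<open>z\<close> satisfies \<open>p * z = z = q * z\<close>, so
  \<open>p - q\<close> annihilates it, and a left inverse of \<open>p - q\<close> gives
  \<open>z = 0\<close>.\<close>

lemma Int_right_ideals_of_invertible_diff:
  fixes p q :: "'a::ring_1"
  assumes p: "p * p = p" and q: "q * q = q" and inv: "p - q \<in> invertible_elements"
  shows "principal_right_ideal p \<inter> principal_right_ideal q = {0}"
proof -
  obtain s where s: "s * (p - q) = 1" using inv unfolding invertible_elements_def by blast
  have "p * c = 0" if "p * c = q * d" for c d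
  proof -
    have "(p - q) * (p * c) = p * p * c - q * q * d" using that by (simp add: algebra_simps)
    also have "\<dots> = 0" using p q that by simp
    finally have "s * (p - q) * (p * c) = 0" by (simp add: mult.assoc)
    then show ?thesis using s by simp
  qed
  then show ?thesis by (simp add: Int_principal_right_ideals_eq_0_iff)
qed

section \<open>Direct sums and multiplication operators in the Banach algebra\<close>

lemma csubspace_principal_right_ideal:
  "csubspace (principal_right_ideal (x :: 'a::complex_banach_algebra_1))"
proof (rule complex_vector.subspaceI)
  show "0 \<in> principal_right_ideal x"
    unfolding principal_right_ideal_def by (simp, metis mult_zero_right)
next
  fix y z assume "y \<in> principal_right_ideal x" "z \<in> principal_right_ideal x"
  then show "y + z \<in> principal_right_ideal x"
    unfolding principal_right_ideal_def by (auto simp flip: distrib_left)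
next
  fix c y assume "y \<in> principal_right_ideal x"
  then show "c *\<^sub>C y \<in> principal_right_ideal x"
    unfolding principal_right_ideal_def by (auto simp flip: mult_scaleC_right)
qed

lemma csubspace_principal_left_ideal:
  "csubspace (principal_left_ideal (x :: 'a::complex_banach_algebra_1))"
proof (rule complex_vector.subspaceI)
  show "0 \<in> principal_left_ideal x"
    unfolding principal_left_ideal_def by (simp, metis mult_zero_left)
next
  fix y z assume "y \<in> principal_left_ideal x" "z \<in> principal_left_ideal x"
  then show "y + z \<in> principal_left_ideal x"
    unfolding principal_left_ideal_def by (auto simp flip: distrib_right)
next
  fix c y assume "y \<in> principal_left_ideal x"
  then show "c *\<^sub>C y \<in> principal_left_ideal x"
    unfolding principal_left_ideal_def by (auto simp flip: mult_scaleC_left)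
qed

lemma right_ideals_sum_eq_UNIV_iff:
  fixes x y :: "'a::ring_1"
  shows "UNIV = {s + t | s t. s \<in> principal_right_ideal x \<and> t \<in> principal_right_ideal y} \<longleftrightarrow>
    (\<exists>s \<in> principal_right_ideal x. \<exists>t \<in> principal_right_ideal y. s + t = 1)"
    (is "UNIV = ?S \<longleftrightarrow> ?R")
proof
  assume "UNIV = ?S"
  then have "1 \<in> ?S" by blast
  then show ?R by force
next
  assume ?R
  then obtain u v where uv: "x * u + y * v = 1" by (auto simp: principal_right_ideal_def)
  have "z = x * (u * z) + y * (v * z)" for z
    using uv by (metis distrib_right mult.assoc mult_1_left)
  then show "UNIV = ?S" unfolding principal_right_ideal_def by blast
qed

lemma left_ideals_sum_eq_UNIV_iff:
  fixes x y :: "'a::ring_1"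
  shows "UNIV = {s + t | s t. s \<in> principal_left_ideal x \<and> t \<in> principal_left_ideal y} \<longleftrightarrow>
    (\<exists>s \<in> principal_left_ideal x. \<exists>t \<in> principal_left_ideal y. s + t = 1)"
    (is "UNIV = ?S \<longleftrightarrow> ?R")
proof
  assume "UNIV = ?S"
  then have "1 \<in> ?S" by blast
  then show ?R by force
next
  assume ?R
  then obtain u v where uv: "u * x + v * y = 1" by (auto simp: principal_left_ideal_def)
  have "z = (z * u) * x + (z * v) * y" for z
    using uv by (metis distrib_left mult.assoc mult_1_right)
  then show "UNIV = ?S" unfolding principal_left_ideal_def by blast
qed

lemma complementary_iff_direct_sums:
  fixes x y :: "'a::complex_banach_algebra_1"
  shows "complementary x y \<longleftrightarrow>
    is_direct_sum UNIV (principal_right_ideal x) (principal_right_ideal y) \<and>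
    is_direct_sum UNIV (principal_left_ideal x) (principal_left_ideal y)"
  unfolding complementary_def is_direct_sum_def right_ideals_sum_eq_UNIV_iff
    left_ideals_sum_eq_UNIV_iff
  by (auto simp: csubspace_principal_right_ideal csubspace_principal_left_ideal)

lemma bounded_clinear_left_mult: "bounded_clinear (left_mult c)"
  unfolding bounded_clinear_def left_mult_def
proof
  show "Vector_Spaces.linear scaleC scaleC ((*) c)"
    by unfold_locales (simp_all add: distrib_left mult_scaleC_right)
  \<comment> \<open>The bound is \<open>norm c\<close>, by submultiplicativity of the norm.\<close>
  show "\<exists>K. \<forall>x. norm (c * x) \<le> norm x * K"
    by (metis norm_mult_ineq mult.commute)
qed

lemma bounded_clinear_right_mult: "bounded_clinear (right_mult c)"
  unfolding bounded_clinear_def right_mult_def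
proof
  show "Vector_Spaces.linear scaleC scaleC (\<lambda>x. x * c)"
    by unfold_locales (simp_all add: distrib_right mult_scaleC_left)
  show "\<exists>K. \<forall>x. norm (x * c) \<le> norm x * K"
    by (metis norm_mult_ineq)
qed

text \<open>Right inverses of the two operators, evaluated at 1, give a right inverse and a left
  inverse of \<open>c\<close>. Conversely, the multiplications by the inverse of \<open>c\<close>
  are bounded right inverses.\<close>

lemma invertible_iff_right_invertible_multiplications:
  fixes c :: "'a::complex_banach_algebra_1"
  shows "c \<in> invertible_elements \<longleftrightarrow>
    right_invertible_operator (left_mult c) \<and> right_invertible_operator (right_mult c)"
    (is "_ \<longleftrightarrow> ?R")
proof
  assume "c \<in> invertible_elements"
  then obtain d where d: "c * d = 1" "d * c = 1" by (auto simp: invertible_elements_def)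
  have "left_mult c \<circ> left_mult d = id" "right_mult c \<circ> right_mult d = id"
    using d by (auto simp: left_mult_def right_mult_def fun_eq_iff mult.assoc)
      (simp flip: mult.assoc)
  then show ?R
    unfolding right_invertible_operator_def
    using bounded_clinear_left_mult bounded_clinear_right_mult by blast
next
  assume ?R
  then obtain F G where "left_mult c \<circ> F = id" "right_mult c \<circ> G = id"
    by (auto simp: right_invertible_operator_def)
  then have "c * F 1 = 1" "G 1 * c = 1"
    by (simp_all add: left_mult_def right_mult_def fun_eq_iff)
  then show "c \<in> invertible_elements" by (rule invertible_elementsI)
qed

section \<open>The equivalences for an element and its Moore-Penrose inverse\<close>

theorem theorem2p2:
  fixes a :: "'a::complex_banach_algebra_1" and lam mu :: complex
  assumes "moore_penrose_invertible a"
    and "lam \<noteq> 0" and "mu \<noteq> 0"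
  shows "(a * a\<^sup>\<dagger> - a\<^sup>\<dagger> * a \<in> invertible_elements \<longleftrightarrow>
        is_direct_sum UNIV (principal_right_ideal a) (principal_right_ideal (a\<^sup>\<dagger>))
        \<and> is_direct_sum UNIV (principal_left_ideal a) (principal_left_ideal (a\<^sup>\<dagger>)))
    \<and> (a * a\<^sup>\<dagger> - a\<^sup>\<dagger> * a \<in> invertible_elements \<longleftrightarrow>
        lam *\<^sub>C a + mu *\<^sub>C a\<^sup>\<dagger> \<in> invertible_elements
        \<and> principal_right_ideal a \<inter> principal_right_ideal (a\<^sup>\<dagger>) = {0})
    \<and> (a * a\<^sup>\<dagger> - a\<^sup>\<dagger> * a \<in> invertible_elements \<longleftrightarrow>
        lam *\<^sub>C a + mu *\<^sub>C a\<^sup>\<dagger> \<in> invertible_elements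
        \<and> (\<exists>h. idempotent h \<and> h * a = a \<and> h * a\<^sup>\<dagger> = 0))
    \<and> (a * a\<^sup>\<dagger> - a\<^sup>\<dagger> * a \<in> invertible_elements \<longleftrightarrow>
        right_invertible_operator (left_mult (lam *\<^sub>C a + mu *\<^sub>C a\<^sup>\<dagger>))
        \<and> right_invertible_operator (right_mult (lam *\<^sub>C a + mu *\<^sub>C a\<^sup>\<dagger>))
        \<and> principal_right_ideal a \<inter> principal_right_ideal (a\<^sup>\<dagger>) = {0})
    \<and> (a * a\<^sup>\<dagger> - a\<^sup>\<dagger> * a \<in> invertible_elements \<longleftrightarrow>
        a * a\<^sup>\<dagger> + a\<^sup>\<dagger> * a \<in> invertible_elements
        \<and> principal_right_ideal a \<inter> principal_right_ideal (a\<^sup>\<dagger>) = {0})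
    \<and> (a * a\<^sup>\<dagger> - a\<^sup>\<dagger> * a \<in> invertible_elements \<longleftrightarrow>
        lam *\<^sub>C a + mu *\<^sub>C a\<^sup>\<dagger> \<in> invertible_elements
        \<and> (\<exists>k. idempotent k \<and> a * k = a \<and> a\<^sup>\<dagger> * k = 0))
    \<and> (a * a\<^sup>\<dagger> - a\<^sup>\<dagger> * a \<in> invertible_elements \<longleftrightarrow>
        a * a\<^sup>\<dagger> + a\<^sup>\<dagger> * a \<in> invertible_elements
        \<and> principal_left_ideal a \<inter> principal_left_ideal (a\<^sup>\<dagger>) = {0})
    \<and> (a * a\<^sup>\<dagger> - a\<^sup>\<dagger> * a \<in> invertible_elements \<longleftrightarrow>
        lam *\<^sub>C a + mu *\<^sub>C a\<^sup>\<dagger> \<in> invertible_elements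
        \<and> principal_left_ideal a \<inter> principal_left_ideal (a\<^sup>\<dagger>) = {0})"
proof -
  define b where "b = a\<^sup>\<dagger>"
  obtain x where x: "is_moore_penrose_inverse a x"
    using assms(1) by (auto simp: moore_penrose_invertible_def)
  \<comment> \<open>Uniqueness of the Moore-Penrose inverse makes the defining identities of the
    witness \<open>x\<close> available for \<open>b\<close>.\<close>
  then have "b = x" by (simp add: b_def moore_penrose_inverse_eqI)
  with x have aba: "a * b * a = a" and bab: "b * a * b = b"
    by (simp_all add: is_moore_penrose_inverse_def)
  define p q w where "p = a * b" and "q = b * a" and "w = lam *\<^sub>C a + mu *\<^sub>C b"
  have idem: "p * p = p" "q * q = q"
    using aba bab by (simp_all add: p_def q_def flip: mult.assoc)
  have right: "principal_right_ideal p = principal_right_ideal a"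
      "principal_right_ideal q = principal_right_ideal b"
    unfolding p_def q_def using principal_right_ideal_eqI aba bab by blast+
  \<comment> \<open>For left ideals the roles are exchanged: \<open>p = a * b\<close> ends in
    \<open>b\<close> and \<open>b * p = b\<close>, so \<open>p\<close> generates the left ideal of
    \<open>b\<close>, and \<open>q\<close> that of \<open>a\<close>. Hence the commutation facts
    below.\<close>
  have left: "principal_left_ideal p = principal_left_ideal b"
      "principal_left_ideal q = principal_left_ideal a"
    unfolding p_def q_def using principal_left_ideal_eqI aba bab by (metis mult.assoc)+
  note scale = principal_right_ideal_scaleC principal_left_ideal_scaleC assms(2,3)
  have int_commute: "principal_left_ideal b \<inter> principal_left_ideal a
      = principal_left_ideal a \<inter> principal_left_ideal b"
    by blast
  have left_sum_commute:
    "(\<exists>s \<in> principal_left_ideal b. \<exists>t \<in> principal_left_ideal a. s + t = 1) \<longleftrightarrow>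
     (\<exists>s \<in> principal_left_ideal a. \<exists>t \<in> principal_left_ideal b. s + t = 1)"
    by (metis add.commute)
  have w: "complementary (lam *\<^sub>C a) (mu *\<^sub>C b) \<longleftrightarrow> complementary a b"
    unfolding complementary_def by (simp add: scale)
  have pq: "complementary p q \<longleftrightarrow> complementary a b"
    unfolding complementary_def by (simp add: right left int_commute left_sum_commute)
  have pmq: "complementary p (- q) \<longleftrightarrow> complementary a b"
    using pq unfolding complementary_def
    by (simp add: principal_right_ideal_minus principal_left_ideal_minus)
  \<comment> \<open>Invertibility of \<open>p - q\<close> already forces the intersection condition
    in the criterion for \<open>p\<close> and \<open>- q\<close>, because \<open>p\<close> and
    \<open>q\<close> are idempotent.\<close>
  have i: "p - q \<in> invertible_elements \<longleftrightarrow> complementary a b"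
    using Int_right_ideals_of_invertible_diff[OF idem] complementary_iff_right[of p "- q"] pmq
    by (auto simp: principal_right_ideal_minus)
  have iii: "complementary a b \<longleftrightarrow> w \<in> invertible_elements \<and>
      principal_right_ideal a \<inter> principal_right_ideal b = {0}"
    using complementary_iff_right[of "lam *\<^sub>C a" "mu *\<^sub>C b"] w by (simp add: scale w_def)
  have ix: "complementary a b \<longleftrightarrow> w \<in> invertible_elements \<and>
      principal_left_ideal a \<inter> principal_left_ideal b = {0}"
    using complementary_iff_left[of "lam *\<^sub>C a" "mu *\<^sub>C b"] w by (simp add: scale w_def)
  \<comment> \<open>Since \<open>lam\<close> and \<open>mu\<close> are nonzero, they cancel from the
    conditions on \<open>h\<close> for the scaled pair.\<close>
  have iv: "complementary a b \<longleftrightarrow> w \<in> invertible_elements \<and>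
      (\<exists>h. idempotent h \<and> h * a = a \<and> h * b = 0)"
    using Int_right_ideals_iff_idempotent[of "lam *\<^sub>C a" "mu *\<^sub>C b"] iii assms(2,3)
    by (auto simp: scale w_def mult_scaleC_right)
  have vii: "complementary a b \<longleftrightarrow> w \<in> invertible_elements \<and>
      (\<exists>k. idempotent k \<and> a * k = a \<and> b * k = 0)"
    using Int_left_ideals_iff_idempotent[of "lam *\<^sub>C a" "mu *\<^sub>C b"] ix assms(2,3)
    by (auto simp: scale w_def mult_scaleC_left)
  have vi: "complementary a b \<longleftrightarrow> p + q \<in> invertible_elements \<and>
      principal_right_ideal a \<inter> principal_right_ideal b = {0}"
    using complementary_iff_right[of p q] pq by (simp add: right)
  have viii: "complementary a b \<longleftrightarrow> p + q \<in> invertible_elements \<and>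
      principal_left_ideal a \<inter> principal_left_ideal b = {0}"
    using complementary_iff_left[of p q] pq by (simp add: left int_commute)
  have v: "complementary a b \<longleftrightarrow> right_invertible_operator (left_mult w) \<and>
      right_invertible_operator (right_mult w) \<and>
      principal_right_ideal a \<inter> principal_right_ideal b = {0}"
    using iii invertible_iff_right_invertible_multiplications[of w] by blast
  show ?thesis
    \<comment> \<open>Rewriting with \<open>i\<close> turns every conjunct into an equivalence with
      \<open>complementary a b\<close>.\<close>
    unfolding b_def[symmetric] p_def[symmetric] q_def[symmetric] w_def[symmetric] i
    by (intro conjI complementary_iff_direct_sums iii iv v vi vii viii ix)
qed

end
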